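(* Let $\mathscr{Z}=L^2(\Xi,\boldsymbol{\Xi},\mu;\mathbb{R})$ be a random function space, and let $\{\Phi_j\}_{j=1}^\infty$ be an ordered set of linearly independent functions in $\mathscr{Z}$ such that the constant functions are not in the set. Then $\{\Psi_j\}_{j=0}^\infty$ is an orthogonal basis in $\mathscr{Z}$ given by $$\Psi_j:=\Phi_j-\mathbf{E}[\Phi_j]\,\Psi_0-\sum_{k=1}^{j-1}\frac{\det\triangle_k(j)}{\det\square_k}\,\Psi_k\quad\text{with}\quad\Psi_0\equiv1,$$ where, for $k\in\{1,2,\ldots\}$, $\square_k$ is the real $k\times k$ covariance matrix for the first $k$ elements of $\{\Phi_j\}_{j=1}^\infty$, $$\square_k=\begin{bmatrix}\mathrm{Cov}[\Phi_1,\Phi_1]&\cdots&\mathrm{Cov}[\Phi_1,\Phi_k]\\ \vdots&\ddots&\vdots\\ \mathrm{Cov}[\Phi_k,\Phi_1]&\cdots&\mathrm{Cov}[\Phi_k,\Phi_k]\end{bmatrix},$$ and $\triangle_k$ is the map from $\{k+1,k+2,\ldots\}$ to the real $k\times k$ matrices defined by $$\triangle_k(j)=\begin{bmatrix}\mathrm{Cov}[\Phi_1,\Phi_1]&\cdots&\mathrm{Cov}[\Phi_1,\Phi_k]\\ \vdots&\ddots&\vdots\\ \mathrm{Cov}[\Phi_{k-1},\Phi_1]&\cdots&\mathrm{Cov}[\Phi_{k-1},\Phi_k]\\ \mathrm{Cov}[\Phi_j,\Phi_1]&\cdots&\mathrm{Cov}[\Phi_j,\Phi_k]\end{bmatrix},$$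 with $\triangle_1(j)=\mathrm{Cov}[\Phi_j,\Phi_1]$ and $$\triangle_2(j)=\begin{bmatrix}\mathrm{Cov}[\Phi_1,\Phi_1]&\mathrm{Cov}[\Phi_1,\Phi_2]\\ \mathrm{Cov}[\Phi_j,\Phi_1]&\mathrm{Cov}[\Phi_j,\Phi_2]\end{bmatrix}.$$
   Context: Random space: $(\Xi,\boldsymbol{\Xi},\mu)$ is a probability space with $\Xi\subset\mathbb{R}^d$, $\boldsymbol{\Xi}$ the trace on $\Xi$ of the Borel $\sigma$-algebra of $\mathbb{R}^d$, and $\mu$ the pushforward of a probability measure by an $\mathbb{R}^d$-valued random variable with range $\Xi$. Random function space: $\mathscr{Z}=L^2(\Xi,\boldsymbol{\Xi},\mu;\mathbb{R})$ is the Hilbert space of (equivalence classes of) measurable functions $f:\Xi\to\mathbb{R}$ that are square-integrable with respect to $\mu$, with inner product $\langle f,g\rangle=\int fg\,\mathrm{d}\mu$. Orthogonality is with respect to this inner product. For $f,g\in\mathscr{Z}$: $\mathbf{E}[f]=\int f\,\mathrm{d}\mu$ and $\mathrm{Cov}[f,g]=\mathbf{E}\big[(f-\mathbf{E}[f])(g-\mathbf{E}[g])\big]$. The formula for $\Psi_j$ is recursive and applies for $j\ge1$, with $\Psi_0$ the constant function $1$; an empty sum is zero.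
   Formalization: "Constant functions are not in the set" is strengthened to: no nonzero constant lies in the linear span of the Φ_j; and the Ψ_j are shown to be an orthogonal basis of the closed span of {1, Φ_1, Φ_2, …}, hence of Z when that span is all of Z. As printed the statement fails otherwise. *)

theory Defs
  imports "HOL-Probability.Probability" "Jordan_Normal_Form.Determinant"
begin

text \<open>The law of \<open>\<xi>\<close> on its range \<open>\<Xi>\<close>, with the trace of the Borel \<open>\<sigma>\<close>-algebra.\<close>

definition random_space :: "'w measure \<Rightarrow> ('w \<Rightarrow> real ^ 'd) \<Rightarrow> (real ^ 'd) measure" where
  "random_space P \<xi> = distr P (restrict_space borel (\<xi> ` space P)) \<xi>"

text \<open>Elements of \<open>L\<^sup>2(M)\<close> are represented by functions; equality in \<open>L\<^sup>2(M)\<close> is almost-everywhere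
  equality. All subsets of \<open>L\<^sup>2(M)\<close> introduced as subspaces below are closed under it.\<close>

definition L2_space :: "'a measure \<Rightarrow> ('a \<Rightarrow> real) set" where
  "L2_space M = {f \<in> borel_measurable M. integrable M (\<lambda>x. (f x)\<^sup>2)}"

definition L2_inner :: "'a measure \<Rightarrow> ('a \<Rightarrow> real) \<Rightarrow> ('a \<Rightarrow> real) \<Rightarrow> real" where
  "L2_inner M f g = (\<integral>x. f x * g x \<partial>M)"

definition L2_norm :: "'a measure \<Rightarrow> ('a \<Rightarrow> real) \<Rightarrow> real" where
  "L2_norm M f = sqrt (L2_inner M f f)"

definition L2_independent :: "'a measure \<Rightarrow> 'i set \<Rightarrow> ('i \<Rightarrow> 'a \<Rightarrow> real) \<Rightarrow> bool" where
  "L2_independent M I F \<longleftrightarrow>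
     (\<forall>J c. finite J \<longrightarrow> J \<subseteq> I \<longrightarrow> (AE x in M. (\<Sum>j\<in>J. c j * F j x) = 0) \<longrightarrow> (\<forall>j\<in>J. c j = 0))"

definition L2_span :: "'a measure \<Rightarrow> ('a \<Rightarrow> real) set \<Rightarrow> ('a \<Rightarrow> real) set" where
  "L2_span M S = {g \<in> L2_space M.
     \<exists>T c. finite T \<and> T \<subseteq> S \<and> (AE x in M. g x = (\<Sum>f\<in>T. c f * f x))}"

definition L2_closed_span :: "'a measure \<Rightarrow> ('a \<Rightarrow> real) set \<Rightarrow> ('a \<Rightarrow> real) set" where
  "L2_closed_span M S = {g \<in> L2_space M.
     \<forall>\<epsilon>>0. \<exists>h\<in>L2_span M S. L2_norm M (\<lambda>x. g x - h x) < \<epsilon>}"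

definition L2_orthogonal_basis ::
  "'a measure \<Rightarrow> (nat \<Rightarrow> 'a \<Rightarrow> real) \<Rightarrow> ('a \<Rightarrow> real) set \<Rightarrow> bool" where
  "L2_orthogonal_basis M F V \<longleftrightarrow>
     (\<forall>j. F j \<in> V) \<and>
     (\<forall>j. L2_norm M (F j) \<noteq> 0) \<and>
     (\<forall>i j. i \<noteq> j \<longrightarrow> L2_inner M (F i) (F j) = 0) \<and>
     L2_closed_span M (range F) = V"

definition expect :: "'a measure \<Rightarrow> ('a \<Rightarrow> real) \<Rightarrow> real" where
  "expect M f = (\<integral>x. f x \<partial>M)"

definition Cov :: "'a measure \<Rightarrow> ('a \<Rightarrow> real) \<Rightarrow> ('a \<Rightarrow> real) \<Rightarrow> real" where
  "Cov M f g = expect M (\<lambda>x. (f x - expect M f) * (g x - expect M g))"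

text \<open>The family \<open>\<Phi>\<close> is indexed from 1 (its value at 0 is never used), whereas matrix indices
  start from 0.\<close>

definition cov_mat :: "'a measure \<Rightarrow> (nat \<Rightarrow> 'a \<Rightarrow> real) \<Rightarrow> nat \<Rightarrow> real mat" where
  "cov_mat M \<Phi> k = Matrix.mat k k (\<lambda>(r, s). Cov M (\<Phi> (r + 1)) (\<Phi> (s + 1)))"

definition cov_mat_last :: "'a measure \<Rightarrow> (nat \<Rightarrow> 'a \<Rightarrow> real) \<Rightarrow> nat \<Rightarrow> nat \<Rightarrow> real mat" where
  "cov_mat_last M \<Phi> k j = Matrix.mat k k
     (\<lambda>(r, s). Cov M (if r + 1 = k then \<Phi> j else \<Phi> (r + 1)) (\<Phi> (s + 1)))"

fun \<Psi> :: "'a measure \<Rightarrow> (nat \<Rightarrow> 'a \<Rightarrow> real) \<Rightarrow> nat \<Rightarrow> 'a \<Rightarrow> real" where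
  "\<Psi> M \<Phi> j = (if j = 0 then (\<lambda>x. 1) else
     (\<lambda>x. \<Phi> j x - expect M (\<Phi> j) * \<Psi> M \<Phi> 0 x
        - (\<Sum>k\<in>{1..<j}. Determinant.det (cov_mat_last M \<Phi> k j) / Determinant.det (cov_mat M \<Phi> k)
             * \<Psi> M \<Phi> k x)))"

declare \<Psi>.simps [simp del]

end

theory Submission
  imports Defs
begin

text \<open>
  Write \<open>\<phi>\<^sub>j = \<Phi>\<^sub>j - E[\<Phi>\<^sub>j]\<close>, so that \<open>Cov[\<Phi>\<^sub>i, \<Phi>\<^sub>j] = \<langle>\<phi>\<^sub>i, \<phi>\<^sub>j\<rangle>\<close>, and note that
  \<open>\<Psi>\<^sub>k\<close> is a unitriangular combination of \<open>\<phi>\<^sub>1, \<dots>, \<phi>\<^sub>k\<close>. Multiplying a Gram matrix with columns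
  \<open>\<phi>\<^sub>1, \<dots>, \<phi>\<^sub>k\<close> on the right by the corresponding unitriangular matrix turns its columns into
  \<open>\<Psi>\<^sub>1, \<dots>, \<Psi>\<^sub>k\<close> without changing the determinant. If \<open>\<Psi>\<^sub>1, \<dots>, \<Psi>\<^sub>k\<close> are already orthogonal, the
  result is lower triangular, so the quotient of the two determinants is the Fourier coefficient
  \<open>\<langle>\<phi>\<^sub>j, \<Psi>\<^sub>k\<rangle> / \<parallel>\<Psi>\<^sub>k\<parallel>\<^sup>2\<close>: the recursion is the Gram--Schmidt process applied to
  \<open>1, \<Phi>\<^sub>1, \<Phi>\<^sub>2, \<dots>\<close>. It does not degenerate because a vanishing \<open>\<Psi>\<^sub>k\<close> would exhibit a constant
  as a nontrivial combination of the \<open>\<Phi>\<^sub>j\<close>.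
\<close>

section \<open>Square-integrable functions\<close>

text \<open>The product is dominated by the sum of the squares. Every later splitting of an inner
  product rests on this, since a nonintegrable function has integral 0 by convention.\<close>

lemma L2_space_mult_integrable:
  assumes "f \<in> L2_space M" "g \<in> L2_space M"
  shows "integrable M (\<lambda>x. f x * g x)"
proof (rule Bochner_Integration.integrable_bound)
  show "integrable M (\<lambda>x. (f x)\<^sup>2 + (g x)\<^sup>2)"
    using assms by (simp add: L2_space_def)
  show "(\<lambda>x. f x * g x) \<in> borel_measurable M"
    using assms by (auto simp: L2_space_def)
  have "\<bar>a * b\<bar> \<le> a\<^sup>2 + b\<^sup>2" for a b :: real
  proof -
    have "2 * (\<bar>a\<bar> * \<bar>b\<bar>) \<le> a\<^sup>2 + b\<^sup>2"
      using sum_squares_bound[of "\<bar>a\<bar>" "\<bar>b\<bar>"] by simp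
    moreover have "0 \<le> \<bar>a\<bar> * \<bar>b\<bar>" by simp
    ultimately show ?thesis unfolding abs_mult by linarith
  qed
  then show "AE x in M. norm (f x * g x) \<le> norm ((f x)\<^sup>2 + (g x)\<^sup>2)"
    by simp
qed

lemma L2_space_zero: "(\<lambda>x. 0) \<in> L2_space M"
  by (simp add: L2_space_def)

lemma L2_space_scale: "f \<in> L2_space M \<Longrightarrow> (\<lambda>x. c * f x) \<in> L2_space M"
  by (auto simp: L2_space_def power_mult_distrib)

lemma L2_space_add:
  assumes "f \<in> L2_space M" "g \<in> L2_space M"
  shows "(\<lambda>x. f x + g x) \<in> L2_space M"
  using assms L2_space_mult_integrable[OF assms]
  by (auto simp: L2_space_def power2_sum mult.assoc)

lemma L2_space_diff:
  assumes "f \<in> L2_space M" "g \<in> L2_space M"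
  shows "(\<lambda>x. f x - g x) \<in> L2_space M"
  using L2_space_add[OF assms(1) L2_space_scale[OF assms(2), of "-1"]] by simp

lemma L2_space_sum:
  "(\<And>i. i \<in> J \<Longrightarrow> F i \<in> L2_space M) \<Longrightarrow> (\<lambda>x. \<Sum>i\<in>J. c i * F i x) \<in> L2_space M"
  by (induction J rule: infinite_finite_induct)
     (auto intro!: L2_space_zero L2_space_add L2_space_scale)

lemma (in prob_space) L2_space_const: "(\<lambda>x. c) \<in> L2_space M"
  by (simp add: L2_space_def)

lemma L2_inner_commute: "L2_inner M f g = L2_inner M g f"
  by (simp add: L2_inner_def mult.commute)

lemma L2_inner_diff_left:
  assumes "f \<in> L2_space M" "g \<in> L2_space M" "h \<in> L2_space M"
  shows "L2_inner M (\<lambda>x. f x - g x) h = L2_inner M f h - L2_inner M g h"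
  using assms by (simp add: L2_inner_def left_diff_distrib L2_space_mult_integrable)

lemma L2_inner_sum_left:
  assumes "\<And>i. i \<in> J \<Longrightarrow> F i \<in> L2_space M" "h \<in> L2_space M"
  shows "L2_inner M (\<lambda>x. \<Sum>i\<in>J. c i * F i x) h = (\<Sum>i\<in>J. c i * L2_inner M (F i) h)"
  using assms by (simp add: L2_inner_def sum_distrib_right mult.assoc L2_space_mult_integrable)

lemma L2_inner_self_eq_0_iff:
  assumes "f \<in> L2_space M"
  shows "L2_inner M f f = 0 \<longleftrightarrow> (AE x in M. f x = 0)"
  using integral_nonneg_eq_0_iff_AE[OF L2_space_mult_integrable[OF assms assms]]
  by (simp add: L2_inner_def)

section \<open>Spans\<close>

lemma L2_span_superset: "f \<in> S \<Longrightarrow> f \<in> L2_space M \<Longrightarrow> f \<in> L2_span M S"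
  unfolding L2_span_def by (auto intro!: exI[of _ "{f}"] exI[of _ "\<lambda>_. 1"])

lemma L2_span_AE_cong:
  assumes "f \<in> L2_span M S" "g \<in> L2_space M" "AE x in M. g x = f x"
  shows "g \<in> L2_span M S"
proof -
  obtain T c where T: "finite T" "T \<subseteq> S" "AE x in M. f x = (\<Sum>h\<in>T. c h * h x)"
    using assms(1) unfolding L2_span_def by blast
  have "AE x in M. g x = (\<Sum>h\<in>T. c h * h x)"
    using assms(3) T(3) by eventually_elim simp
  then show ?thesis
    using T assms(2) unfolding L2_span_def by blast
qed

lemma L2_span_zero: "(\<lambda>x. 0) \<in> L2_span M S"
  unfolding L2_span_def by (auto simp: L2_space_zero intro!: exI[of _ "{}"])

lemma L2_span_scale:
  assumes "f \<in> L2_span M S"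
  shows "(\<lambda>x. a * f x) \<in> L2_span M S"
proof -
  obtain T c where T: "finite T" "T \<subseteq> S" "AE x in M. f x = (\<Sum>h\<in>T. c h * h x)"
    and f: "f \<in> L2_space M"
    using assms unfolding L2_span_def by blast
  have "AE x in M. a * f x = (\<Sum>h\<in>T. (a * c h) * h x)"
    using T(3) by eventually_elim (simp add: sum_distrib_left mult.assoc)
  then show ?thesis
    using T L2_space_scale[OF f] unfolding L2_span_def
    by (auto intro!: exI[of _ T] exI[of _ "\<lambda>h. a * c h"])
qed

lemma L2_span_add:
  assumes "f \<in> L2_span M S" "g \<in> L2_span M S"
  shows "(\<lambda>x. f x + g x) \<in> L2_span M S"
proof -
  obtain T c where T: "finite T" "T \<subseteq> S" "AE x in M. f x = (\<Sum>h\<in>T. c h * h x)"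
    and f: "f \<in> L2_space M"
    using assms(1) unfolding L2_span_def by blast
  obtain U d where U: "finite U" "U \<subseteq> S" "AE x in M. g x = (\<Sum>h\<in>U. d h * h x)"
    and g: "g \<in> L2_space M"
    using assms(2) unfolding L2_span_def by blast
  \<comment> \<open>Coefficients are indexed by the functions themselves, so on the overlap of
    \<open>T\<close> and \<open>U\<close> they must be added.\<close>
  define e where "e h = (if h \<in> T then c h else 0) + (if h \<in> U then d h else 0)" for h
  have e: "(\<Sum>h\<in>T \<union> U. e h * h x) = (\<Sum>h\<in>T. c h * h x) + (\<Sum>h\<in>U. d h * h x)" for x
  proof -
    have "(\<Sum>h\<in>T. c h * h x) = (\<Sum>h\<in>T \<union> U. (if h \<in> T then c h else 0) * h x)"
      using T U by (intro sum.mono_neutral_cong_left) auto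
    moreover have "(\<Sum>h\<in>U. d h * h x) = (\<Sum>h\<in>T \<union> U. (if h \<in> U then d h else 0) * h x)"
      using T U by (intro sum.mono_neutral_cong_left) auto
    ultimately show ?thesis
      by (simp add: e_def distrib_right sum.distrib)
  qed
  have "AE x in M. f x + g x = (\<Sum>h\<in>T \<union> U. e h * h x)"
    using T(3) U(3) by eventually_elim (simp add: e)
  then show ?thesis
    using T U L2_space_add[OF f g] unfolding L2_span_def
    by (auto intro!: exI[of _ "T \<union> U"] exI[of _ e])
qed

lemma L2_span_sum:
  "(\<And>i. i \<in> J \<Longrightarrow> F i \<in> L2_span M S) \<Longrightarrow> (\<lambda>x. \<Sum>i\<in>J. c i * F i x) \<in> L2_span M S"
  by (induction J rule: infinite_finite_induct)
     (auto intro!: L2_span_zero L2_span_add L2_span_scale)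

lemma L2_span_minimal:
  assumes "S \<subseteq> L2_span M S'"
  shows "L2_span M S \<subseteq> L2_span M S'"
proof
  fix g assume "g \<in> L2_span M S"
  then obtain T c where T: "finite T" "T \<subseteq> S" "AE x in M. g x = (\<Sum>f\<in>T. c f * f x)"
    and g: "g \<in> L2_space M"
    unfolding L2_span_def by blast
  have "(\<lambda>x. \<Sum>f\<in>T. c f * f x) \<in> L2_span M S'"
    using L2_span_sum[of T "\<lambda>f. f"] T(2) assms by blast
  then show "g \<in> L2_span M S'"
    using L2_span_AE_cong g T(3) by blast
qed

lemma L2_span_subset_closed_span: "L2_span M S \<subseteq> L2_closed_span M S"
proof
  fix g assume g: "g \<in> L2_span M S"
  then have "g \<in> L2_space M"
    by (simp add: L2_span_def)
  with g show "g \<in> L2_closed_span M S"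
    by (auto simp: L2_closed_span_def L2_norm_def L2_inner_def intro!: bexI[of _ g])
qed

section \<open>Determinants\<close>

text \<open>\<open>U\<close> has determinant 1, so \<open>A\<close> and the lower triangular matrix
  \<open>A * U\<close> have the same determinant, which is read off the diagonal.\<close>

lemma det_eq_prod_if_mult_unitriangular:
  fixes A U :: "'a :: idom mat"
  assumes A: "A \<in> carrier_mat k k" and U: "U \<in> carrier_mat k k"
    and upper: "\<And>i s. s < i \<Longrightarrow> i < k \<Longrightarrow> U $$ (i, s) = 0"
    and unit: "\<And>i. i < k \<Longrightarrow> U $$ (i, i) = 1"
    and lower: "\<And>r s. r < s \<Longrightarrow> s < k \<Longrightarrow> (A * U) $$ (r, s) = 0"
  shows "Determinant.det A = (\<Prod>r<k. (A * U) $$ (r, r))"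
proof -
  have diag: "prod_list (diag_mat B) = (\<Prod>r<k. B $$ (r, r))"
    if "B \<in> carrier_mat k k" for B :: "'a mat"
    using that by (auto simp: prod_list_diag_prod atLeast0LessThan)
  have "Determinant.det U = 1"
    using det_upper_triangular[OF _ U] upper unit U diag[OF U] by (auto simp: upper_triangular_def)
  then have "Determinant.det A = Determinant.det (A * U)"
    using det_mult[OF A U] by simp
  also have "\<dots> = prod_list (diag_mat (A * U))"
    using lower A U by (intro det_lower_triangular[of k]) auto
  finally show ?thesis
    using diag A U by simp
qed

section \<open>The Gram--Schmidt recursion\<close>

text \<open>Constants are excluded from the span, not merely from the set: for nonconstant
  \<open>f\<close>, the independent pair \<open>f\<close>, \<open>f + 1\<close> contains no
  constant, yet its second member would give a vanishing \<open>\<Psi>\<close>.\<close>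

locale L2_family = prob_space M for M :: "'a measure" +
  fixes \<Phi> :: "nat \<Rightarrow> 'a \<Rightarrow> real"
  assumes \<Phi>_L2: "j \<ge> 1 \<Longrightarrow> \<Phi> j \<in> L2_space M"
    and independent: "L2_independent M {1..} \<Phi>"
    and const_not_in_span: "c \<noteq> 0 \<Longrightarrow> (\<lambda>x. c) \<notin> L2_span M (\<Phi> ` {1..})"
begin

section \<open>Centred functions, unitriangular expansion and nondegeneracy\<close>

definition \<phi> :: "nat \<Rightarrow> 'a \<Rightarrow> real" where
  "\<phi> j = (\<lambda>x. \<Phi> j x - expect M (\<Phi> j))"

definition coef :: "nat \<Rightarrow> nat \<Rightarrow> real" where
  "coef j k = Determinant.det (cov_mat_last M \<Phi> k j) / Determinant.det (cov_mat M \<Phi> k)"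

lemma \<Psi>_0: "\<Psi> M \<Phi> 0 = (\<lambda>x. 1)"
  by (simp add: \<Psi>.simps)

lemma \<Psi>_rec: "j \<ge> 1 \<Longrightarrow> \<Psi> M \<Phi> j = (\<lambda>x. \<phi> j x - (\<Sum>k\<in>{1..<j}. coef j k * \<Psi> M \<Phi> k x))"
  by (subst \<Psi>.simps) (simp add: \<Psi>_0 \<phi>_def coef_def)

lemma Cov_eq_inner: "Cov M (\<Phi> i) (\<Phi> j) = L2_inner M (\<phi> i) (\<phi> j)"
  by (simp add: Cov_def L2_inner_def expect_def \<phi>_def)

lemma \<phi>_L2: "j \<ge> 1 \<Longrightarrow> \<phi> j \<in> L2_space M"
  unfolding \<phi>_def by (intro L2_space_diff \<Phi>_L2 L2_space_const)

lemma \<Psi>_L2: "\<Psi> M \<Phi> j \<in> L2_space M"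
proof (induction j rule: less_induct)
  case (less j)
  show ?case
  proof (cases "j = 0")
    case True
    then show ?thesis by (simp add: \<Psi>_0 L2_space_const)
  next
    case False
    then show ?thesis
      using less by (auto simp: \<Psi>_rec[of j] intro!: L2_space_diff \<phi>_L2 L2_space_sum)
  qed
qed

lemma \<phi>_inner_one:
  assumes "j \<ge> 1"
  shows "L2_inner M (\<phi> j) (\<lambda>x. 1) = 0"
proof -
  have "integrable M (\<Phi> j)"
    using L2_space_mult_integrable[OF \<Phi>_L2[OF assms] L2_space_const[of 1]] by simp
  then show ?thesis
    by (simp add: L2_inner_def \<phi>_def expect_def prob_space)
qed

text \<open>This is true for any values of \<open>coef\<close>, so it is available before the
  denominators are known to be nonzero. One \<open>c\<close>, padded by zeros, serves all lengths
  \<open>n\<close>, so that several \<open>\<Psi>\<close> can be expanded over a common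
  range.\<close>

lemma \<Psi>_unitriangular:
  assumes "s \<ge> 1"
  shows "\<exists>c. c s = 1 \<and> (\<forall>i>s. c i = 0) \<and> (\<forall>n\<ge>s. \<forall>x. \<Psi> M \<Phi> s x = (\<Sum>i=1..n. c i * \<phi> i x))"
  using assms
proof (induction s rule: less_induct)
  case (less s)
  then have "\<forall>k\<in>{1..<s}. \<exists>c. c k = 1 \<and> (\<forall>i>k. c i = 0) \<and>
      (\<forall>n\<ge>k. \<forall>x. \<Psi> M \<Phi> k x = (\<Sum>i=1..n. c i * \<phi> i x))"
    by simp
  then obtain C where "\<forall>k\<in>{1..<s}. C k k = 1 \<and> (\<forall>i>k. C k i = 0) \<and>
      (\<forall>n\<ge>k. \<forall>x. \<Psi> M \<Phi> k x = (\<Sum>i=1..n. C k i * \<phi> i x))"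
    by (subst (asm) bchoice_iff) blast
  then have C0: "\<And>k i. k \<in> {1..<s} \<Longrightarrow> i > k \<Longrightarrow> C k i = 0"
    and C: "\<And>k n x. k \<in> {1..<s} \<Longrightarrow> n \<ge> k \<Longrightarrow> \<Psi> M \<Phi> k x = (\<Sum>i=1..n. C k i * \<phi> i x)"
    by blast+
  \<comment> \<open>Coefficients obtained by substituting the expansions of the earlier
    \<open>\<Psi>\<close> into the recursion.\<close>
  define c where "c i = (if i = s then 1 else 0) - (\<Sum>k\<in>{1..<s}. coef s k * C k i)" for i
  have "\<Psi> M \<Phi> s x = (\<Sum>i=1..n. c i * \<phi> i x)" if n: "n \<ge> s" for n x
  proof -
    have "(\<Sum>i=1..n. c i * \<phi> i x) = (\<Sum>i=1..n. if i = s then \<phi> i x else 0)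
        - (\<Sum>i=1..n. \<Sum>k\<in>{1..<s}. coef s k * (C k i * \<phi> i x))"
      unfolding sum_subtractf[symmetric]
      by (rule sum.cong) (auto simp: c_def left_diff_distrib sum_distrib_right mult.assoc)
    also have "(\<Sum>i=1..n. if i = s then \<phi> i x else 0) = \<phi> s x"
      using n less.prems by simp
    also have "(\<Sum>i=1..n. \<Sum>k\<in>{1..<s}. coef s k * (C k i * \<phi> i x))
        = (\<Sum>k\<in>{1..<s}. coef s k * (\<Sum>i=1..n. C k i * \<phi> i x))"
      by (subst sum.swap) (simp add: sum_distrib_left)
    also have "\<dots> = (\<Sum>k\<in>{1..<s}. coef s k * \<Psi> M \<Phi> k x)"
      using n by (intro sum.cong refl) (subst C[of _ n], auto)
    finally show ?thesis
      using less.prems by (simp add: \<Psi>_rec[of s])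
  qed
  moreover have "c s = 1" "\<forall>i>s. c i = 0"
    using C0 by (auto simp: c_def)
  ultimately show ?case by blast
qed

lemma \<Psi>_not_AE_zero:
  assumes s: "s \<ge> 1"
  shows "\<not> (AE x in M. \<Psi> M \<Phi> s x = 0)"
proof
  assume zero: "AE x in M. \<Psi> M \<Phi> s x = 0"
  obtain c where c: "c s = 1" "\<And>x. \<Psi> M \<Phi> s x = (\<Sum>i=1..s. c i * \<phi> i x)"
    using \<Psi>_unitriangular[OF s] by blast
  \<comment> \<open>Undoing the centring collects all expectations in the constant \<open>a\<close>,
    which then equals a combination of the \<open>\<Phi>\<close> with coefficient 1 at
    \<open>s\<close>. If \<open>a = 0\<close> this contradicts independence, otherwise the exclusion
    of constants from the span.\<close>
  define a where "a = (\<Sum>i=1..s. c i * expect M (\<Phi> i))"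
  have AE_a: "AE x in M. a = (\<Sum>i=1..s. c i * \<Phi> i x)"
    using zero by eventually_elim (simp add: c(2) a_def \<phi>_def right_diff_distrib sum_subtractf)
  show False
  proof (cases "a = 0")
    case True
    then have "AE x in M. (\<Sum>i\<in>{1..s}. c i * \<Phi> i x) = 0"
      using AE_a by simp
    moreover have "finite {1..s}" "{1..s} \<subseteq> {1..}" by auto
    ultimately have "\<forall>i\<in>{1..s}. c i = 0"
      using independent unfolding L2_independent_def by blast
    then show False using c(1) s by auto
  next
    case False
    have "(\<lambda>x. \<Sum>i=1..s. c i * \<Phi> i x) \<in> L2_span M (\<Phi> ` {1..})"
      by (intro L2_span_sum L2_span_superset \<Phi>_L2) auto
    then have "(\<lambda>x. a) \<in> L2_span M (\<Phi> ` {1..})"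
      using L2_span_AE_cong L2_space_const AE_a by blast
    then show False using const_not_in_span False by blast
  qed
qed

lemma \<Psi>_inner_self: "L2_inner M (\<Psi> M \<Phi> j) (\<Psi> M \<Phi> j) \<noteq> 0"
proof (cases "j = 0")
  case True
  then show ?thesis by (simp add: \<Psi>_0 L2_inner_def prob_space)
next
  case False
  then show ?thesis
    using \<Psi>_not_AE_zero[of j] L2_inner_self_eq_0_iff[OF \<Psi>_L2] by simp
qed

section \<open>Gram determinants and Fourier coefficients\<close>

text \<open>The row functions \<open>f\<close> are left free so that \<open>cov_mat\<close> and
  \<open>cov_mat_last\<close>, which differ only in the last row, are both instances.\<close>

lemma det_Gram:
  assumes f: "\<And>r. r < k \<Longrightarrow> f r \<in> L2_space M"
    and lower: "\<And>r s. r < s \<Longrightarrow> s < k \<Longrightarrow> L2_inner M (f r) (\<Psi> M \<Phi> (Suc s)) = 0"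
  shows "Determinant.det (Matrix.mat k k (\<lambda>(r, s). L2_inner M (f r) (\<phi> (Suc s))))
    = (\<Prod>r<k. L2_inner M (f r) (\<Psi> M \<Phi> (Suc r)))"
proof -
  obtain C where C1: "\<And>s. C (Suc s) (Suc s) = 1"
    and C0: "\<And>s i. i > s \<Longrightarrow> C (Suc s) (Suc i) = 0"
    and C: "\<And>s n. Suc s \<le> n \<Longrightarrow> \<Psi> M \<Phi> (Suc s) = (\<lambda>x. \<Sum>i=1..n. C (Suc s) i * \<phi> i x)"
  proof -
    have "\<forall>s\<in>{1..}. \<exists>c. c s = 1 \<and> (\<forall>i>s. c i = 0) \<and>
        (\<forall>n\<ge>s. \<forall>x. \<Psi> M \<Phi> s x = (\<Sum>i=1..n. c i * \<phi> i x))"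
      using \<Psi>_unitriangular by simp
    then obtain C where "\<forall>s\<in>{1..}. C s s = 1 \<and> (\<forall>i>s. C s i = 0) \<and>
        (\<forall>n\<ge>s. \<forall>x. \<Psi> M \<Phi> s x = (\<Sum>i=1..n. C s i * \<phi> i x))"
      by (subst (asm) bchoice_iff) blast
    then show ?thesis
      by (intro that[of C]) (auto simp: fun_eq_iff)
  qed
  define A where "A = Matrix.mat k k (\<lambda>(r, s). L2_inner M (f r) (\<phi> (Suc s)))"
  \<comment> \<open>Column \<open>s\<close> holds the coordinates of \<open>\<Psi>\<close> at
    \<open>Suc s\<close>, so multiplying by \<open>U\<close> replaces the column functions
    \<open>\<phi>\<close> by \<open>\<Psi>\<close>.\<close>
  define U where "U = Matrix.mat k k (\<lambda>(i, s). C (Suc s) (Suc i))"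
  have carr: "A \<in> carrier_mat k k" "U \<in> carrier_mat k k"
    by (auto simp: A_def U_def)
  have entry: "(A * U) $$ (r, s) = L2_inner M (f r) (\<Psi> M \<Phi> (Suc s))" if "r < k" "s < k" for r s
  proof -
    have "(A * U) $$ (r, s) = (\<Sum>i<k. C (Suc s) (Suc i) * L2_inner M (\<phi> (Suc i)) (f r))"
      using that by (auto simp: A_def U_def scalar_prod_def atLeast0LessThan mult.commute
          L2_inner_commute[of M "f r"] intro!: sum.cong)
    also have "\<dots> = (\<Sum>i=1..k. C (Suc s) i * L2_inner M (\<phi> i) (f r))"
      by (simp add: sum.atLeast1_atMost_eq)
    also have "\<dots> = L2_inner M (\<Psi> M \<Phi> (Suc s)) (f r)"
      using that f by (subst C[of s k], simp) (rule L2_inner_sum_left[symmetric], auto intro: \<phi>_L2)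
    finally show ?thesis by (simp add: L2_inner_commute)
  qed
  have "Determinant.det A = (\<Prod>r<k. (A * U) $$ (r, r))"
    using carr
    by (rule det_eq_prod_if_mult_unitriangular) (simp_all add: entry lower, simp_all add: U_def C0 C1)
  then show ?thesis
    by (simp add: A_def[symmetric] entry)
qed

text \<open>The two functions at \<open>r\<close> differ by a combination of \<open>\<Psi>\<close>
  at indices below \<open>r\<close>, all orthogonal to the one at \<open>s\<close>. For
  \<open>r < s\<close> this gives the zeros above the diagonal, for \<open>r = s\<close> the
  diagonal entry.\<close>

lemma \<phi>_inner_\<Psi>:
  assumes r: "1 \<le> r" "r \<le> s"
    and orth: "\<And>k. k < s \<Longrightarrow> L2_inner M (\<Psi> M \<Phi> k) (\<Psi> M \<Phi> s) = 0"
  shows "L2_inner M (\<phi> r) (\<Psi> M \<Phi> s) = L2_inner M (\<Psi> M \<Phi> r) (\<Psi> M \<Phi> s)"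
proof -
  have "L2_inner M (\<Psi> M \<Phi> r) (\<Psi> M \<Phi> s)
      = L2_inner M (\<phi> r) (\<Psi> M \<Phi> s) - (\<Sum>k\<in>{1..<r}. coef r k * L2_inner M (\<Psi> M \<Phi> k) (\<Psi> M \<Phi> s))"
    using r by (subst \<Psi>_rec[of r]) (auto simp: L2_inner_diff_left L2_inner_sum_left L2_space_sum \<phi>_L2 \<Psi>_L2)
  also have "(\<Sum>k\<in>{1..<r}. coef r k * L2_inner M (\<Psi> M \<Phi> k) (\<Psi> M \<Phi> s)) = 0"
    using r orth by (intro sum.neutral) auto
  finally show ?thesis by simp
qed

lemma det_cov_mat:
  assumes orth: "\<And>i j. i < j \<Longrightarrow> j \<le> k \<Longrightarrow> L2_inner M (\<Psi> M \<Phi> i) (\<Psi> M \<Phi> j) = 0"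
  shows "Determinant.det (cov_mat M \<Phi> k)
    = (\<Prod>r<k. L2_inner M (\<Psi> M \<Phi> (Suc r)) (\<Psi> M \<Phi> (Suc r)))"
proof -
  have "cov_mat M \<Phi> k = Matrix.mat k k (\<lambda>(r, s). L2_inner M (\<phi> (Suc r)) (\<phi> (Suc s)))"
    by (simp add: cov_mat_def Cov_eq_inner)
  then show ?thesis
    using orth by (simp add: det_Gram \<phi>_L2 \<phi>_inner_\<Psi>)
qed

text \<open>The last row has no entry above the diagonal, so an arbitrary \<open>\<phi> j\<close>
  may stand there; only the last factor differs from \<open>det_cov_mat\<close>.\<close>

lemma det_cov_mat_last:
  assumes j: "1 \<le> j"
    and orth: "\<And>i j. i < j \<Longrightarrow> j \<le> Suc k \<Longrightarrow> L2_inner M (\<Psi> M \<Phi> i) (\<Psi> M \<Phi> j) = 0"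
  shows "Determinant.det (cov_mat_last M \<Phi> (Suc k) j)
    = (\<Prod>r<k. L2_inner M (\<Psi> M \<Phi> (Suc r)) (\<Psi> M \<Phi> (Suc r))) * L2_inner M (\<phi> j) (\<Psi> M \<Phi> (Suc k))"
proof -
  define f where "f r = (if r = k then \<phi> j else \<phi> (Suc r))" for r
  have "cov_mat_last M \<Phi> (Suc k) j = Matrix.mat (Suc k) (Suc k) (\<lambda>(r, s). L2_inner M (f r) (\<phi> (Suc s)))"
    by (auto simp: cov_mat_last_def Cov_eq_inner f_def)
  also have "Determinant.det \<dots> = (\<Prod>r<Suc k. L2_inner M (f r) (\<Psi> M \<Phi> (Suc r)))"
    using orth j by (intro det_Gram) (auto simp: f_def \<phi>_L2 \<phi>_inner_\<Psi>)
  also have "\<dots> = (\<Prod>r<k. L2_inner M (f r) (\<Psi> M \<Phi> (Suc r))) * L2_inner M (f k) (\<Psi> M \<Phi> (Suc k))"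
    by simp
  also have "(\<Prod>r<k. L2_inner M (f r) (\<Psi> M \<Phi> (Suc r)))
      = (\<Prod>r<k. L2_inner M (\<Psi> M \<Phi> (Suc r)) (\<Psi> M \<Phi> (Suc r)))"
    using orth by (intro prod.cong) (auto simp: f_def \<phi>_inner_\<Psi>)
  finally show ?thesis by (simp add: f_def)
qed

text \<open>The common nonzero factors of the two determinants cancel. Orthogonality is assumed only
  up to \<open>k\<close>, which makes the lemma usable inside the induction that proves
  orthogonality.\<close>

lemma coef_eq_Fourier:
  assumes "1 \<le> j" "1 \<le> k"
    and orth: "\<And>i j. i < j \<Longrightarrow> j \<le> k \<Longrightarrow> L2_inner M (\<Psi> M \<Phi> i) (\<Psi> M \<Phi> j) = 0"
  shows "coef j k = L2_inner M (\<phi> j) (\<Psi> M \<Phi> k) / L2_inner M (\<Psi> M \<Phi> k) (\<Psi> M \<Phi> k)"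
proof -
  obtain m where "k = Suc m"
    using assms(2) by (cases k) auto
  then show ?thesis
    using assms(1) orth by (simp add: coef_def det_cov_mat det_cov_mat_last \<Psi>_inner_self)
qed

text \<open>Strong induction on the larger index. For \<open>i = 0\<close> centring suffices; for
  \<open>i > 0\<close> the only coefficient that matters is \<open>coef j i\<close>, a Fourier
  coefficient by the induction hypothesis.\<close>

lemma \<Psi>_orthogonal_less: "i < j \<Longrightarrow> L2_inner M (\<Psi> M \<Phi> i) (\<Psi> M \<Phi> j) = 0"
proof (induction j arbitrary: i rule: less_induct)
  case (less j)
  then have j: "1 \<le> j" by simp
  let ?ip = "\<lambda>k. L2_inner M (\<Psi> M \<Phi> k) (\<Psi> M \<Phi> i)"
  have expand: "L2_inner M (\<Psi> M \<Phi> j) (\<Psi> M \<Phi> i)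
      = L2_inner M (\<phi> j) (\<Psi> M \<Phi> i) - (\<Sum>k\<in>{1..<j}. coef j k * ?ip k)"
    using j by (subst \<Psi>_rec[of j]) (auto simp: L2_inner_diff_left L2_inner_sum_left L2_space_sum \<phi>_L2 \<Psi>_L2)
  have orth: "?ip k = 0" if "k < j" "k \<noteq> i" for k
    using that less.IH[of i k] less.IH[of k i] less.prems
    by (cases "k < i") (auto simp: L2_inner_commute)
  have "L2_inner M (\<Psi> M \<Phi> j) (\<Psi> M \<Phi> i) = 0"
  proof (cases "i = 0")
    case True
    have "(\<Sum>k\<in>{1..<j}. coef j k * ?ip k) = 0"
      using True orth by (intro sum.neutral) auto
    then show ?thesis
      using expand True \<phi>_inner_one[OF j] by (simp add: \<Psi>_0)
  next
    case False
    \<comment> \<open>Only \<open>k = i\<close> survives, and its term is exactly the projection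
      that cancels the first summand of \<open>expand\<close>.\<close>
    have "(\<Sum>k\<in>{1..<j}. coef j k * ?ip k) = (\<Sum>k\<in>{i}. coef j k * ?ip k)"
      using False less.prems orth by (intro sum.mono_neutral_right) auto
    also have "\<dots> = L2_inner M (\<phi> j) (\<Psi> M \<Phi> i)"
      using False less j by (simp add: coef_eq_Fourier \<Psi>_inner_self)
    finally show ?thesis
      using expand by simp
  qed
  then show ?case by (simp add: L2_inner_commute)
qed

lemma \<Psi>_orthogonal: "i \<noteq> j \<Longrightarrow> L2_inner M (\<Psi> M \<Phi> i) (\<Psi> M \<Phi> j) = 0"
  using \<Psi>_orthogonal_less[of i j] \<Psi>_orthogonal_less[of j i]
  by (cases "i < j") (auto simp: L2_inner_commute)

lemma det_cov_mat_neq_0: "Determinant.det (cov_mat M \<Phi> k) \<noteq> 0"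
  by (simp add: det_cov_mat \<Psi>_orthogonal_less \<Psi>_inner_self)

section \<open>Equality of spans and the basis property\<close>

lemma \<Psi>_in_span: "\<Psi> M \<Phi> j \<in> L2_span M ({\<lambda>x. 1} \<union> \<Phi> ` {1..})" (is "_ \<in> ?V")
proof (induction j rule: less_induct)
  case (less j)
  have one: "(\<lambda>x. 1) \<in> ?V"
    by (intro L2_span_superset L2_space_const) auto
  show ?case
  proof (cases "j = 0")
    case True
    then show ?thesis using one by (simp add: \<Psi>_0)
  next
    case False
    have "\<Phi> j \<in> ?V"
      using False by (intro L2_span_superset \<Phi>_L2) auto
    moreover have "(\<lambda>x. \<Sum>k\<in>{1..<j}. (- coef j k) * \<Psi> M \<Phi> k x) \<in> ?V"
      using less by (intro L2_span_sum) auto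
    ultimately have "(\<lambda>x. (\<Phi> j x + (- expect M (\<Phi> j)) * 1)
        + (\<Sum>k\<in>{1..<j}. (- coef j k) * \<Psi> M \<Phi> k x)) \<in> ?V"
      using one by (intro L2_span_add L2_span_scale)
    then show ?thesis
      using False by (simp add: \<Psi>_rec[of j] \<phi>_def sum_negf)
  qed
qed

lemma \<Phi>_in_span:
  assumes "j \<ge> 1"
  shows "\<Phi> j \<in> L2_span M (range (\<Psi> M \<Phi>))"
proof -
  have \<Psi>: "\<Psi> M \<Phi> k \<in> L2_span M (range (\<Psi> M \<Phi>))" for k
    by (intro L2_span_superset \<Psi>_L2) auto
  have "\<Phi> j = (\<lambda>x. (\<Psi> M \<Phi> j x + (\<Sum>k\<in>{1..<j}. coef j k * \<Psi> M \<Phi> k x))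
      + expect M (\<Phi> j) * \<Psi> M \<Phi> 0 x)"
    using assms by (simp add: \<Psi>_0 \<Psi>_rec[of j] \<phi>_def)
  also have "\<dots> \<in> L2_span M (range (\<Psi> M \<Phi>))"
    by (intro L2_span_add L2_span_scale L2_span_sum \<Psi>)
  finally show ?thesis .
qed

lemma span_\<Psi>: "L2_span M (range (\<Psi> M \<Phi>)) = L2_span M ({\<lambda>x. 1} \<union> \<Phi> ` {1..})"
proof (rule antisym; rule L2_span_minimal)
  show "range (\<Psi> M \<Phi>) \<subseteq> L2_span M ({\<lambda>x. 1} \<union> \<Phi> ` {1..})"
    using \<Psi>_in_span by blast
  have "(\<lambda>x. 1) \<in> L2_span M (range (\<Psi> M \<Phi>))"
    using \<Psi>_0 by (intro L2_span_superset L2_space_const) (metis rangeI)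
  then show "{\<lambda>x. 1} \<union> \<Phi> ` {1..} \<subseteq> L2_span M (range (\<Psi> M \<Phi>))"
    using \<Phi>_in_span by auto
qed

lemma \<Psi>_orthogonal_basis:
  "L2_orthogonal_basis M (\<Psi> M \<Phi>) (L2_closed_span M ({\<lambda>x. 1} \<union> \<Phi> ` {1..}))"
  unfolding L2_orthogonal_basis_def
proof (intro conjI allI impI)
  show "\<Psi> M \<Phi> j \<in> L2_closed_span M ({\<lambda>x. 1} \<union> \<Phi> ` {1..})" for j
    using \<Psi>_in_span L2_span_subset_closed_span by blast
  show "L2_norm M (\<Psi> M \<Phi> j) \<noteq> 0" for j
    using \<Psi>_inner_self by (simp add: L2_norm_def)
  \<comment> \<open>The closed span depends on the generating set only through its algebraic
    span.\<close>
  show "L2_closed_span M (range (\<Psi> M \<Phi>)) = L2_closed_span M ({\<lambda>x. 1} \<union> \<Phi> ` {1..})"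
    by (simp only: L2_closed_span_def span_\<Psi>)
qed (rule \<Psi>_orthogonal)

end

lemma prob_space_random_space:
  assumes "prob_space P" "\<xi> \<in> borel_measurable P"
  shows "prob_space (random_space P \<xi>)"
  unfolding random_space_def
  using assms by (intro prob_space.prob_space_distr measurable_restrict_space2) auto

text \<open>The hypotheses on the family do not force density, so the basis property is stated for
  the closed span of 1 and the \<open>\<Phi>\<close>, and for the whole space when the two coincide.
  The nonzero determinants ensure that no quotient in the recursion is a division by zero, which
  would silently yield 0.\<close>

theorem theorem1:
  fixes P :: "'w measure" and \<xi> :: "'w \<Rightarrow> real ^ 'd"
    and \<mu> :: "(real ^ 'd) measure" and \<Phi> :: "nat \<Rightarrow> real ^ 'd \<Rightarrow> real"
  assumes "prob_space P" and "\<xi> \<in> borel_measurable P" and "\<mu> = random_space P \<xi>"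
    and "\<And>j. j \<ge> 1 \<Longrightarrow> \<Phi> j \<in> L2_space \<mu>"
    and "L2_independent \<mu> {1..} \<Phi>"
    and "\<And>c. c \<noteq> 0 \<Longrightarrow> (\<lambda>x. c) \<notin> L2_span \<mu> (\<Phi> ` {1..})"
  shows "(\<forall>k\<ge>1. Determinant.det (cov_mat \<mu> \<Phi> k) \<noteq> 0) \<and>
    L2_orthogonal_basis \<mu> (\<Psi> \<mu> \<Phi>) (L2_closed_span \<mu> ({\<lambda>x. 1} \<union> \<Phi> ` {1..})) \<and>
    (L2_closed_span \<mu> ({\<lambda>x. 1} \<union> \<Phi> ` {1..}) = L2_space \<mu> \<longrightarrow>
      L2_orthogonal_basis \<mu> (\<Psi> \<mu> \<Phi>) (L2_space \<mu>))"
proof -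
  interpret prob_space \<mu>
    using assms(1-3) prob_space_random_space by simp
  interpret L2_family \<mu> \<Phi>
    by unfold_locales (use assms(4-6) in auto)
  show ?thesis
    using det_cov_mat_neq_0 \<Psi>_orthogonal_basis by metis
qed

end
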